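(* Let $m,n\in\mathbb N$ (positive integers), let $\mathcal A,\mathcal B\subseteq\overline{\mathbb F}_q$ be Frobenius invariant sets, and let $\diamond:\mathcal A\times\mathcal B\to\overline{\mathbb F}_q$ be a diamond product. Then the following statements are equivalent: (1) The element $\alpha\diamond\beta$ belongs to $\mathcal F_q(mn)$ for any $\alpha\in\mathcal A^{\mathrm p}_m$ and $\beta\in\mathcal B^{\mathrm p}_n$. (2) The polynomial $f\diamond g$ is irreducible over $\mathbb F_q$ for any monic irreducible $f,g\in\mathbb F_q[X]$ with their zeros belonging to $\mathcal A^{\mathrm p}_m$ and $\mathcal B^{\mathrm p}_n$, respectively. (3) $\gcd(m,n)=1$ and $\diamond$ satisfies conjugate cancellation on $\mathcal A^{\mathrm p}_m\times\mathcal B^{\mathrm p}_n$.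
   Context: Let $q$ be a prime power and $\overline{\mathbb F}_q$ an algebraic closure of $\mathbb F_q$, with $\mathbb F_{q^n}\subseteq\overline{\mathbb F}_q$. Put $\mathcal F_q(n)=\{\alpha\in\mathbb F_{q^n}:\mathbb F_q(\alpha)=\mathbb F_{q^n}\}$. A set $\mathcal A\subseteq\overline{\mathbb F}_q$ is Frobenius invariant if $\alpha^q\in\mathcal A$ for all $\alpha\in\mathcal A$; put $\mathcal A^{\mathrm p}_m=\mathcal A\cap\mathcal F_q(m)$ and $\mathcal B^{\mathrm p}_n=\mathcal B\cap\mathcal F_q(n)$. For Frobenius invariant $\mathcal A,\mathcal B$, a map $\diamond:\mathcal A\times\mathcal B\to\overline{\mathbb F}_q$ is a diamond product if $(\alpha\diamond\beta)^q=\alpha^q\diamond\beta^q$ for all $(\alpha,\beta)\in\mathcal A\times\mathcal B$. The composed product of monic polynomials $f,g\in\mathbb F_q[X]$ whose zeros lie in $\mathcal A$ and $\mathcal B$, respectively, is $f\diamond g=\prod_\alpha\prod_\beta(X-\alpha\diamond\beta)$, where $\alpha$ and $\beta$ range over the zeros of $f$ and $g$, respectively; it lies in $\mathbb F_q[X]$. Conjugate cancellation: $\diamond$ satisfies conjugate cancellation on $\mathcal A^{\mathrm p}_m\times\mathcal B^{\mathrm p}_n$ if for every integer $k$ with $\gcd(m,n)\mid k$ and all $\alpha\in\mathcal A^{\mathrm p}_m$, $\beta\in\mathcal B^{\mathrm p}_n$: $\alpha\diamond\beta=\alpha^{q^k}\diamond\beta$ implies $\alpha=\alpha^{q^k}$,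 and $\alpha\diamond\beta=\alpha\diamond\beta^{q^k}$ implies $\beta=\beta^{q^k}$. (Here $x\mapsto x^{q^k}$ is the $k$-th power of the Frobenius automorphism $x\mapsto x^q$.)
   Formalization: The formal theorem additionally assumes that A^p_m and B^p_n are both nonempty or gcd(m,n)=1; otherwise (1) and (2) hold vacuously while (3) fails (e.g. A empty, m=n=2). *)

theory Defs
  imports "HOL-Algebra.Sylow" "HOL-Algebra.Generated_Fields" "HOL-Algebra.Algebraic_Closure_Type" "HOL-Library.Cardinality"
begin

text \<open>
  The field with \<open>q\<close> elements is a type \<open>'k\<close> of class \<^class>\<open>finite_field\<close>, so that
  \<open>q = CARD('k)\<close> (a prime power, by \<open>ex_card_eq_CHAR_power\<close>), and its algebraic closure is the type \<open>'k alg_closure\<close> with the embedding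
  \<^const>\<open>to_ac\<close>. The record \<^const>\<open>ring_of_type_algebra\<close> views that type as a structure, which
  gives access to subfields and generated subfields.
\<close>

text \<open>
  The subfield with \<open>q ^ n\<close> elements; see \<open>ex1_subfield\<close> for existence and uniqueness
  and \<open>Fqn_eq\<close> for the description as the set of roots of \<open>X ^ (q ^ n) - X\<close>, for \<open>n > 0\<close>.
\<close>
definition Fqn :: "nat \<Rightarrow> 'k::finite_field alg_closure set" where
  "Fqn n = (THE K. subfield K (ring_of_type_algebra :: 'k alg_closure ring) \<and> card K = CARD('k) ^ n)"

definition adjoin :: "'k::field alg_closure \<Rightarrow> 'k alg_closure set" where
  "adjoin \<alpha> = generate_field ring_of_type_algebra (insert \<alpha> (range to_ac))"

definition gens :: "nat \<Rightarrow> 'k::finite_field alg_closure set" where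
  "gens n = {\<alpha> \<in> Fqn n. adjoin \<alpha> = Fqn n}"

definition frob :: "'k::finite_field alg_closure \<Rightarrow> 'k alg_closure" where
  "frob x = x ^ CARD('k)"

text \<open>
  Integer powers of the Frobenius automorphism, negative exponents included. See \<open>bij_frob\<close> for
  bijectivity and \<open>frob_pow_of_nat\<close> for \<open>k \<ge> 0\<close>.
\<close>
definition frob_pow :: "int \<Rightarrow> 'k::finite_field alg_closure \<Rightarrow> 'k alg_closure" where
  "frob_pow k = (if k \<ge> 0 then frob ^^ nat k else inv_into UNIV frob ^^ nat (- k))"

definition frobenius_invariant :: "'k::finite_field alg_closure set \<Rightarrow> bool" where
  "frobenius_invariant A \<longleftrightarrow> (\<forall>\<alpha>\<in>A. frob \<alpha> \<in> A)"

text \<open>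
  A map on \<open>A \<times> B\<close> is given by a total binary function of which only the values on \<open>A \<times> B\<close>
  are ever used.
\<close>
definition diamond_product ::
  "'k::finite_field alg_closure set \<Rightarrow> 'k alg_closure set \<Rightarrow>
     ('k alg_closure \<Rightarrow> 'k alg_closure \<Rightarrow> 'k alg_closure) \<Rightarrow> bool" where
  "diamond_product A B d \<longleftrightarrow> (\<forall>\<alpha>\<in>A. \<forall>\<beta>\<in>B. frob (d \<alpha> \<beta>) = d (frob \<alpha>) (frob \<beta>))"

definition conjugate_cancellation ::
  "'k::finite_field alg_closure set \<Rightarrow> 'k alg_closure set \<Rightarrow> nat \<Rightarrow> nat \<Rightarrow>
     ('k alg_closure \<Rightarrow> 'k alg_closure \<Rightarrow> 'k alg_closure) \<Rightarrow> bool" where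
  "conjugate_cancellation A B m n d \<longleftrightarrow>
     (\<forall>k::int. int (gcd m n) dvd k \<longrightarrow>
        (\<forall>\<alpha>\<in>A \<inter> gens m. \<forall>\<beta>\<in>B \<inter> gens n.
           (d \<alpha> \<beta> = d (frob_pow k \<alpha>) \<beta> \<longrightarrow> \<alpha> = frob_pow k \<alpha>) \<and>
           (d \<alpha> \<beta> = d \<alpha> (frob_pow k \<beta>) \<longrightarrow> \<beta> = frob_pow k \<beta>)))"

text \<open>
  The zeros of a polynomial over the base field, in the algebraic closure and with multiplicity.
\<close>
definition zeros :: "'k::field poly \<Rightarrow> 'k alg_closure multiset" where
  "zeros f = proots (map_poly to_ac f)"

text \<open>
  The composed product as a polynomial over the base field: the unique one whose image over the
  closure is the product below. It exists for monic \<open>f\<close>, \<open>g\<close> with zeros in \<open>A\<close> and \<open>B\<close> if \<open>d\<close>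
  is a diamond product on \<open>A \<times> B\<close>, see \<open>map_poly_composed_product\<close>.
\<close>
definition composed_product ::
  "('k alg_closure \<Rightarrow> 'k alg_closure \<Rightarrow> 'k alg_closure) \<Rightarrow>
     'k::field poly \<Rightarrow> 'k poly \<Rightarrow> 'k poly" where
  "composed_product d f g =
     (THE h. map_poly to_ac h = (\<Prod>\<alpha>\<in>#zeros f. \<Prod>\<beta>\<in>#zeros g. [:- d \<alpha> \<beta>, 1:]))"

lemma ex_card_eq_CHAR_power:
  obtains r where "r > 0" "CARD('k::finite_field) = CHAR('k) ^ r"
proof -
  let ?R = "ring_of_type_algebra :: 'k ring"
  let ?G = "add_monoid ?R"
  interpret R: field ?R by (rule field_from_type_algebra)
  have [simp]: "carrier ?R = UNIV" "add ?R = (+)" "zero ?R = 0"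
    by (auto simp: ring_of_type_algebra_def)
  have p: "Factorial_Ring.prime CHAR('k)" by simp
  have pw: "x [^]\<^bsub>?G\<^esub> (n::nat) = of_nat n * x" for x n
    by (induction n) (auto simp: algebra_simps)
  have div: "s = CHAR('k)" if s: "Factorial_Ring.prime s" "s dvd CARD('k)" for s :: nat
  proof -
    obtain c where c: "CARD('k) = s ^ 1 * c" using s by auto
    have "Coset.order ?G = s ^ 1 * c" using c by (simp add: Coset.order_def)
    then obtain H where H: "subgroup H ?G" "card H = s ^ 1"
      using sylow_thm[OF s(1) R.add.group_axioms, of 1 c] by auto
    have "card H > 1" using H s prime_gt_1_nat by simp
    then obtain x where x: "x \<in> H" "x \<noteq> 0"
      using card_mono[of "{0}" H] by auto
    interpret H: group "?G\<lparr>carrier := H\<rparr>"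
      by (rule R.add.subgroup_imp_group[OF H(1)])
    have "x [^]\<^bsub>?G\<lparr>carrier := H\<rparr>\<^esub> card H = 0"
      using H.pow_order_eq_1[of x] x by (simp add: Coset.order_def)
    hence "x [^]\<^bsub>?G\<^esub> card H = 0"
      by (simp add: nat_pow_def)
    hence "of_nat s = (0 :: 'k)" using x H pw[of x "card H"] by simp
    hence "CHAR('k) dvd s" by (simp add: of_nat_eq_0_iff_char_dvd)
    thus ?thesis using p s(1) by (metis primes_dvd_imp_eq)
  qed
  have "CARD('k) > 1"
    using card_mono[of UNIV "{0, 1 :: 'k}"] by simp
  moreover have "set_mset (prime_factorization CARD('k)) \<subseteq> {CHAR('k)}"
    using div by (auto simp: prime_factors_dvd)
  hence "prime_factorization CARD('k) = replicate_mset (size (prime_factorization CARD('k))) CHAR('k)"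
    by (metis set_mset_subset_singletonD)
  hence "CARD('k) = CHAR('k) ^ size (prime_factorization CARD('k))"
    by (metis prod_mset_prime_factorization_nat prod_mset_replicate_mset zero_less_card_finite)
  ultimately show ?thesis
    by (intro that[of "size (prime_factorization CARD('k))"]) (auto intro!: Nat.gr0I)
qed

lemma power_q_add:
  fixes x y :: "'k::finite_field alg_closure"
  shows "(x + y) ^ (CARD('k) ^ n) = x ^ (CARD('k) ^ n) + y ^ (CARD('k) ^ n)"
proof -
  obtain r where "CARD('k) = CHAR('k) ^ r" using ex_card_eq_CHAR_power[where 'k='k] by blast
  thus ?thesis
    by (intro freshmans_dream'[of _ "r * n"]) (auto simp: power_mult)
qed

lemma power_q_uminus:
  fixes x :: "'k::finite_field alg_closure"
  shows "(- x) ^ (CARD('k) ^ n) = - (x ^ (CARD('k) ^ n))"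
  using power_q_add[of x "- x" n] by (simp add: eq_neg_iff_add_eq_0 add.commute zero_power)

lemma frob_add: "frob (x + y) = frob x + frob y"
  using power_q_add[of x y 1] by (simp add: frob_def)

lemma frob_uminus: "frob (- x) = - frob x"
  using power_q_uminus[of x 1] by (simp add: frob_def)

lemma frob_mult: "frob (x * y) = frob x * frob y"
  by (simp add: frob_def power_mult_distrib)

lemma frob_0 [simp]: "frob 0 = 0" and frob_1 [simp]: "frob 1 = 1"
  by (auto simp: frob_def zero_power)

lemma frob_eq_0_iff [simp]: "frob x = 0 \<longleftrightarrow> x = 0"
  by (auto simp: frob_def)

lemma funpow_frob:
  fixes x :: "'k::finite_field alg_closure"
  shows "(frob ^^ n) x = x ^ (CARD('k) ^ n)"
  by (induction n) (auto simp: frob_def power_mult [symmetric] mult.commute)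

lemma bij_frob: "bij (frob :: 'k::finite_field alg_closure \<Rightarrow> _)"
proof (rule bijI)
  show "inj (frob :: 'k alg_closure \<Rightarrow> _)"
  proof (rule injI)
    fix x y :: "'k alg_closure" assume "frob x = frob y"
    hence "frob (x - y) = 0" using frob_add[of x "-y"] frob_uminus[of y] by simp
    thus "x = y" by simp
  qed
  show "surj (frob :: 'k alg_closure \<Rightarrow> _)"
    using nth_root_exists[of "CARD('k)"] unfolding frob_def surj_def
    by (metis zero_less_card_finite)
qed

lemma frob_pow_of_nat:
  fixes x :: "'k::finite_field alg_closure"
  shows "frob_pow (int n) x = x ^ (CARD('k) ^ n)"
  by (simp add: frob_pow_def funpow_frob)

lemma card_roots:
  assumes "n > 0"
  shows "card {x :: 'k::finite_field alg_closure. x ^ (CARD('k) ^ n) = x} = CARD('k) ^ n"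
proof -
  define Q where "Q = CARD('k) ^ n"
  have q1: "CARD('k) > 1" using card_mono[of UNIV "{0, 1 :: 'k}"] by simp
  hence Q1: "Q > 1" using assms unfolding Q_def by (intro one_less_power)
  define p :: "'k alg_closure poly" where
    "p = Polynomial.monom 1 Q - Polynomial.monom 1 1"
  obtain r where r: "r > 0" "CARD('k) = CHAR('k) ^ r"
    using ex_card_eq_CHAR_power[where 'k='k] by blast
  have "CHAR('k) dvd Q" using r assms by (simp add: Q_def flip: power_mult)
  hence Q0: "of_nat Q = (0 :: 'k alg_closure)" by (simp add: of_nat_eq_0_iff_char_dvd)
  have deg: "Polynomial.degree p = Q"
    using Q1 degree_add_eq_left[of "- Polynomial.monom (1 :: 'k alg_closure) 1" "Polynomial.monom 1 Q"]
    by (simp add: p_def degree_monom_eq)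
  hence p0: "p \<noteq> 0" using Q1 by auto
  have pd: "pderiv p = - 1"
    by (simp add: p_def pderiv_diff pderiv_monom Q0 monom_0 one_pCons)
  obtain A where A: "size A = Polynomial.degree p"
    "p = smult (Polynomial.lead_coeff p) (\<Prod>x\<in>#A. [:-x, 1:])"
    using alg_closed_imp_factorization[OF p0] by blast
  have lc: "Polynomial.lead_coeff p \<noteq> 0" using p0 by simp
  have cnt: "count A x \<le> 1" for x
  proof (rule ccontr)
    assume "\<not> count A x \<le> 1"
    hence "replicate_mset 2 x \<subseteq># A"
      by (simp add: count_le_replicate_mset_subset_eq [symmetric])
    then obtain B where "A = add_mset x (add_mset x B)"
      by (auto simp: mset_subset_eq_exists_conv numeral_2_eq_2)
    then obtain h where h: "p = [:-x, 1:] * ([:-x, 1:] * h)" using A(2)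
      by (metis (no_types, lifting) image_mset_add_mset mult_smult_right prod_mset.add_mset)
    have "poly (pderiv p) x = 0" by (subst h) (simp add: pderiv_mult del: mult_pCons_left)
    thus False by (simp add: pd)
  qed
  have "card (set_mset A) = size A"
  proof -
    have "count A x = 1" if "x \<in># A" for x
      using cnt[of x] that by (metis One_nat_def Suc_leI count_greater_zero_iff le_antisym)
    thus ?thesis by (simp add: size_multiset_overloaded_eq)
  qed
  moreover have "set_mset A = {x. poly p x = 0}"
    by (subst A(2)) (use lc in \<open>auto simp: poly_prod_mset prod_mset_zero_iff\<close>)
  moreover have "{x. poly p x = 0} = {x. x ^ Q = x}"
    by (auto simp: p_def poly_monom)
  ultimately show ?thesis using A(1) deg by (simp add: Q_def)
qed

lemma subfield_roots:
  "subfield {x :: 'k::finite_field alg_closure. x ^ (CARD('k) ^ n) = x} ring_of_type_algebra"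
  (is "subfield ?K ?R")
proof -
  interpret R: field ?R by (rule field_from_type_algebra)
  have [simp]: "carrier ?R = UNIV" "add ?R = (+)" "zero ?R = 0" "monoid.mult ?R = (*)" "one ?R = 1"
    by (auto simp: ring_of_type_algebra_def)
  have [simp]: "\<ominus>\<^bsub>?R\<^esub> x = - x" for x
    using R.l_neg[of x] by (simp add: eq_neg_iff_add_eq_0)
  have [simp]: "inv\<^bsub>?R\<^esub> x = inverse x" if "x \<noteq> 0" for x
    using R.comm_inv_char[of x "inverse x"] that by simp
  show ?thesis
  proof (rule R.subfieldI')
    show "subring ?K ?R"
      by (rule R.subringI) (auto simp: power_q_add power_q_uminus power_mult_distrib)
  next
    fix k assume "k \<in> ?K - {\<zero>\<^bsub>?R\<^esub>}"
    thus "inv\<^bsub>?R\<^esub> k \<in> ?K" by (simp add: power_inverse)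
  qed
qed

lemma subfield_eq_roots:
  assumes K: "subfield K (ring_of_type_algebra :: 'k::finite_field alg_closure ring)"
    and card: "card K = CARD('k) ^ n" and n: "n > 0"
  shows "K = {x. x ^ (CARD('k) ^ n) = x}"
proof -
  let ?R = "ring_of_type_algebra :: 'k alg_closure ring"
  interpret R: field ?R by (rule field_from_type_algebra)
  have R [simp]: "carrier ?R = UNIV" "add ?R = (+)" "zero ?R = 0" "monoid.mult ?R = (*)" "one ?R = 1"
    by (auto simp: ring_of_type_algebra_def)
  have inv [simp]: "inv\<^bsub>?R\<^esub> x = inverse x" if "x \<noteq> 0" for x
    using R.comm_inv_char[of x "inverse x"] that by simp
  have K0: "0 \<in> K" and Km: "x * y \<in> K" if "x \<in> K" "y \<in> K" for x y
    using subringE[OF subfieldE(1)[OF K]] that by auto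
  have Ki: "inverse x \<in> K" if "x \<in> K" "x \<noteq> 0" for x
    using R.subfield_m_inv(1)[OF K, of x] that by auto
  have fin: "finite K" using card by (intro card_ge_0_finite) simp
  have "x ^ card K = x" if x: "x \<in> K" for x
  proof (cases "x = 0")
    case False
    have "0 \<in> K" using K0 x by blast
    hence c: "card K = Suc (card (K - {0}))" using fin by (rule card.remove[rotated])
    have "(\<Prod>y\<in>K-{0}. x * y) = (\<Prod>y\<in>K-{0}. y)"
      by (rule prod.reindex_bij_witness[of _ "\<lambda>y. inverse x * y" "\<lambda>y. x * y"])
         (use False x Km Ki in \<open>auto simp: mult.assoc [symmetric]\<close>)
    hence "x ^ card (K - {0}) * (\<Prod>y\<in>K-{0}. y) = 1 * (\<Prod>y\<in>K-{0}. y)"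
      by (simp add: prod.distrib)
    moreover have "(\<Prod>y\<in>K-{0}. y) \<noteq> 0" using fin by simp
    ultimately have "x ^ card (K - {0}) = 1" by (metis mult_right_cancel)
    thus ?thesis by (simp add: c)
  qed (use card in \<open>simp add: zero_power\<close>)
  hence "K \<subseteq> {x. x ^ (CARD('k) ^ n) = x}" by (auto simp: card)
  moreover have "finite {x :: 'k alg_closure. x ^ (CARD('k) ^ n) = x}"
    by (intro card_ge_0_finite) (simp add: card_roots[OF n])
  ultimately show ?thesis
    by (intro card_subset_eq) (auto simp: card card_roots[OF n])
qed

lemma ex1_subfield:
  assumes "n > 0"
  shows "\<exists>!K. subfield K (ring_of_type_algebra :: 'k::finite_field alg_closure ring) \<and>
              card K = CARD('k) ^ n"
proof (rule ex1I)
  show "subfield {x. x ^ (CARD('k) ^ n) = x} (ring_of_type_algebra :: 'k alg_closure ring) \<and>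
        card {x :: 'k alg_closure. x ^ (CARD('k) ^ n) = x} = CARD('k) ^ n"
    using subfield_roots card_roots[OF assms] by (rule conjI)
qed (elim conjE, rule subfield_eq_roots[OF _ _ assms])

lemma Fqn_eq:
  assumes "n > 0"
  shows "(Fqn n :: 'k::finite_field alg_closure set) = {x. x ^ (CARD('k) ^ n) = x}"
  unfolding Fqn_def
proof (rule the_equality)
  show "subfield {x. x ^ (CARD('k) ^ n) = x} (ring_of_type_algebra :: 'k alg_closure ring) \<and>
        card {x :: 'k alg_closure. x ^ (CARD('k) ^ n) = x} = CARD('k) ^ n"
    using subfield_roots card_roots[OF assms] by (rule conjI)
qed (elim conjE, rule subfield_eq_roots[OF _ _ assms])

lemma range_to_ac: "range to_ac = {x :: 'k::finite_field alg_closure. frob x = x}"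
proof (rule card_subset_eq)
  have *: "{x :: 'k alg_closure. frob x = x} = {x. x ^ (CARD('k) ^ 1) = x}"
    by (simp add: frob_def)
  show "finite {x :: 'k alg_closure. frob x = x}"
    unfolding * by (intro card_ge_0_finite, subst card_roots) auto
  show "range to_ac \<subseteq> {x :: 'k alg_closure. frob x = x}"
    using finite_field_power_card_eq_same[where 'a='k] by (auto simp: frob_def simp flip: to_ac_power)
  show "card (range (to_ac :: 'k \<Rightarrow> _)) = card {x :: 'k alg_closure. frob x = x}"
    unfolding * by (subst card_roots) (auto simp: card_image inj_to_ac)
qed

lemma map_poly_frob_mult: "map_poly frob (p * q) = map_poly frob p * map_poly frob q"
proof (rule poly_eqI)
  have sum: "frob (\<Sum>i\<in>S. g i) = (\<Sum>i\<in>S. frob (g i))" for g :: "nat \<Rightarrow> 'k::finite_field alg_closure" and S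
    by (induction S rule: infinite_finite_induct) (auto simp: frob_add)
  show "Polynomial.coeff (map_poly frob (p * q)) n = Polynomial.coeff (map_poly frob p * map_poly frob q) n" for n
    by (simp add: coeff_map_poly Polynomial.coeff_mult sum frob_mult)
qed

lemma map_poly_frob_prod_mset:
  "map_poly frob (\<Prod>x\<in>#M. f x) = (\<Prod>x\<in>#M. map_poly frob (f x))"
  by (induction M) (auto simp: map_poly_frob_mult)

lemma proots_prod_linear: "proots (\<Prod>x\<in>#A. [:-x, 1:]) = (A :: 'a::idom multiset)"
proof (induction A)
  case (add x A)
  have "(\<Prod>x\<in>#A. [:-x, 1:]) \<noteq> 0" by (auto simp: prod_mset_zero_iff)
  thus ?case using add by (simp add: proots_mult del: mult_pCons_left)
qed auto

lemma prod_zeros: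
  assumes "Polynomial.lead_coeff f = 1"
  shows "map_poly to_ac f = (\<Prod>x\<in>#zeros f. [:-x, 1:])"
proof -
  let ?F = "map_poly to_ac f"
  have lc: "Polynomial.lead_coeff ?F = 1"
    using assms by (simp add: coeff_map_poly map_poly_degree_eq)
  hence "?F \<noteq> 0" by auto
  then obtain A where A: "?F = smult (Polynomial.lead_coeff ?F) (\<Prod>x\<in>#A. [:-x, 1:])"
    using alg_closed_imp_factorization by blast
  hence A': "?F = (\<Prod>x\<in>#A. [:-x, 1:])" using lc by simp
  thus ?thesis by (simp add: zeros_def proots_prod_linear)
qed

lemma image_frob_zeros:
  fixes f :: "'k::finite_field poly"
  assumes "Polynomial.lead_coeff f = 1"
  shows "image_mset frob (zeros f) = zeros f"
proof -
  have "map_poly frob (map_poly to_ac f) = map_poly to_ac f"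
    using range_to_ac[where 'k='k] by (intro poly_eqI) (auto simp: coeff_map_poly)
  hence "(\<Prod>x\<in>#image_mset frob (zeros f). [:-x, 1:]) = (\<Prod>x\<in>#zeros f. [:-x, 1:])"
    unfolding prod_zeros[OF assms] map_poly_frob_prod_mset
    by (simp add: map_poly_pCons frob_uminus multiset.map_comp comp_def)
  thus ?thesis by (metis proots_prod_linear)
qed

lemma map_poly_composed_product:
  fixes f g :: "'k::finite_field poly"
  assumes d: "diamond_product A B d"
    and f: "Polynomial.lead_coeff f = 1" "set_mset (zeros f) \<subseteq> A"
    and g: "Polynomial.lead_coeff g = 1" "set_mset (zeros g) \<subseteq> B"
  shows "map_poly to_ac (composed_product d f g) =
           (\<Prod>\<alpha>\<in>#zeros f. \<Prod>\<beta>\<in>#zeros g. [:- d \<alpha> \<beta>, 1:])" (is "_ = ?P")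
proof -
  have "map_poly frob ?P = (\<Prod>\<alpha>\<in>#zeros f. \<Prod>\<beta>\<in>#zeros g. [:- frob (d \<alpha> \<beta>), 1:])"
    by (simp add: map_poly_frob_prod_mset map_poly_pCons frob_uminus)
  also have "\<dots> = (\<Prod>\<alpha>\<in>#zeros f. \<Prod>\<beta>\<in>#zeros g. [:- d (frob \<alpha>) (frob \<beta>), 1:])"
    using d f g by (intro arg_cong[where f = prod_mset] image_mset_cong)
      (auto simp: diamond_product_def subset_iff)
  also have "\<dots> = (\<Prod>\<alpha>\<in>#image_mset frob (zeros f). \<Prod>\<beta>\<in>#image_mset frob (zeros g). [:- d \<alpha> \<beta>, 1:])"
    by (simp add: multiset.map_comp comp_def)
  also have "\<dots> = ?P" using f g by (simp add: image_frob_zeros)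
  finally have "map_poly frob ?P = ?P" .
  hence "Polynomial.coeff (map_poly frob ?P) i = Polynomial.coeff ?P i" for i
    by (rule arg_cong)
  hence "frob (Polynomial.coeff ?P i) = Polynomial.coeff ?P i" for i
    by (simp only: coeff_map_poly[of frob, OF frob_0])
  hence "Polynomial.coeff ?P i \<in> range to_ac" for i
    unfolding range_to_ac by simp
  hence ex: "map_poly to_ac (map_poly of_ac ?P) = ?P"
    by (intro poly_eqI) (simp add: coeff_map_poly to_ac_of_ac)
  have inj: "h = h'" if "map_poly to_ac h = map_poly to_ac h'" for h h' :: "'k poly"
    using that by (metis coeff_map_poly poly_eqI to_ac_0 to_ac_eq_iff)
  have "\<exists>!h. map_poly to_ac h = ?P"
    by (rule ex1I, rule ex, rule inj, simp only: ex)
  thus ?thesis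
    unfolding composed_product_def by (rule theI')
qed

end

theory Submission
  imports Defs "HOL-Number_Theory.Cong"
begin

text \<open>
  An element generates the field with \<open>q ^ n\<close> elements over the base field iff its period under
  the Frobenius map is \<open>n\<close>, and an irreducible polynomial with root \<open>x\<close> has degree equal to the
  period of \<open>x\<close>. The composed product of irreducible \<open>f\<close> and \<open>g\<close> has degree \<open>deg f * deg g\<close> and
  root \<open>d a b\<close>, so it is irreducible iff the period of \<open>d a b\<close> is the product of the periods \<open>m\<close>
  of \<open>a\<close> and \<open>n\<close> of \<open>b\<close>. Since \<open>d\<close> commutes with the Frobenius map, the period of \<open>d a b\<close>
  divides the least common multiple of \<open>m\<close> and \<open>n\<close>, so it can only be \<open>m * n\<close> if these are
  coprime. For coprime periods, iterating the Frobenius map a multiple of \<open>n\<close> times fixes \<open>b\<close> and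
  acts on \<open>a\<close> as an arbitrary power of the Frobenius map, which links the period of \<open>d a b\<close> to
  conjugate cancellation.
\<close>

section \<open>Iterates of the Frobenius map and their fixed points\<close>

lemma inj_funpow_frob: "inj (frob ^^ k)"
  by (rule bij_is_inj[OF bij_fn[OF bij_frob]])

lemma funpow_frob_fixed_mult:
  assumes "(frob ^^ k) x = x"
  shows "(frob ^^ (k * j)) x = x"
  using assms by (induction j) (auto simp: funpow_add)

lemma funpow_frob_fixed_dvd:
  assumes "(frob ^^ k) x = x" "k dvd l"
  shows "(frob ^^ l) x = x"
proof -
  obtain j where "l = k * j" using assms(2) by (elim dvdE)
  thus ?thesis using funpow_frob_fixed_mult[OF assms(1)] by simp
qed

text \<open>Bezout over the naturals writes \<open>gcd i j\<close> as \<open>i * a - j * b\<close>,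
  and both multiples are iteration counts that fix \<open>x\<close>. This form needs
  \<open>i\<close> nonzero, hence the case split.\<close>

lemma funpow_frob_fixed_gcd:
  assumes "(frob ^^ i) x = x" "(frob ^^ j) x = x"
  shows "(frob ^^ gcd i j) x = x"
proof (cases "i = 0")
  case False
  then obtain a b where "i * a = j * b + gcd i j"
    using bezout_nat by blast
  hence "(frob ^^ (gcd i j + j * b)) x = (frob ^^ (i * a)) x"
    by (simp add: add.commute)
  thus ?thesis
    using funpow_frob_fixed_mult[OF assms(1), of a] funpow_frob_fixed_mult[OF assms(2), of b]
    by (simp add: funpow_add)
qed (use assms in simp)

lemma funpow_frob_fixed_diff:
  assumes "(frob ^^ i) x = (frob ^^ j) x" "i \<le> j"
  shows "(frob ^^ (j - i)) x = x"
proof -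
  have "(frob ^^ i) ((frob ^^ (j - i)) x) = (frob ^^ i) x"
    using assms(1) fun_cong[OF funpow_add[of i "j - i" frob], of x] assms(2) by simp
  thus ?thesis using inj_funpow_frob by (blast dest: injD)
qed

text \<open>Reduces integer exponents to natural ones, so that the inverse of the Frobenius map does
  not appear in later arguments.\<close>

lemma frob_pow_fixed_conv:
  assumes "(frob ^^ m) x = x" "m > 0"
  shows "frob_pow k x = (frob ^^ nat (k mod int m)) x"
proof -
  define r where "r = nat (k mod int m)"
  have r: "int r = k mod int m" using assms(2) by (simp add: r_def)
  show ?thesis
  proof (cases "k \<ge> 0")
    case True
    thus ?thesis using assms by (simp add: frob_pow_def nat_mod_distrib funpow_mod_eq)
  next
    case False
    \<comment> \<open>Here \<open>r - k\<close> is a multiple of \<open>m\<close>, so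
      \<open>- k\<close> further iterations bring the \<open>r\<close>-th iterate back to
      \<open>x\<close>; it is therefore the required preimage.\<close>
    have "int m dvd int (nat (- k) + r)"
      using False dvd_minus_mod[of "int m" k] by (simp add: r dvd_diff_commute)
    hence "(frob ^^ (nat (- k) + r)) x = x" by (intro funpow_frob_fixed_dvd[OF assms(1)]) (simp only: of_nat_dvd_iff)
    hence "(frob ^^ nat (- k)) ((frob ^^ r) x) = x" by (simp add: funpow_add)
    moreover have "inv_into UNIV frob ^^ nat (- k) = inv_into UNIV (frob ^^ nat (- k))"
      by (rule inv_fn[symmetric, OF bij_frob])
    ultimately have "(inv_into UNIV frob ^^ nat (- k)) x = (frob ^^ r) x"
      by (metis inj_funpow_frob inv_f_f)
    thus ?thesis using False by (simp add: frob_pow_def r_def)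
  qed
qed

section \<open>Evaluation of base field polynomials in the closure\<close>

lemma map_poly_to_ac_add: "map_poly to_ac (p + q) = map_poly to_ac p + map_poly to_ac q"
  by (intro poly_eqI) (simp add: coeff_map_poly)

lemma map_poly_to_ac_diff: "map_poly to_ac (p - q) = map_poly to_ac p - map_poly to_ac q"
  by (intro poly_eqI) (simp add: coeff_map_poly)

lemma map_poly_to_ac_mult: "map_poly to_ac (p * q) = map_poly to_ac p * map_poly to_ac q"
  by (intro poly_eqI) (simp add: coeff_map_poly Polynomial.coeff_mult to_ac_sum)

lemma degree_map_poly_to_ac [simp]: "Polynomial.degree (map_poly to_ac p) = Polynomial.degree p"
  by (rule degree_map_poly) simp

lemma map_poly_to_ac_eq_0_iff [simp]: "map_poly to_ac p = 0 \<longleftrightarrow> p = 0"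
  by (rule map_poly_eq_0_iff) auto

lemma poly_frob_to_ac:
  fixes p :: "'k::finite_field poly"
  shows "poly (map_poly to_ac p) (frob x) = frob (poly (map_poly to_ac p) x)"
proof (induction p)
  case (pCons a p)
  have "frob (to_ac a) = to_ac a" using range_to_ac[where 'k='k] by blast
  thus ?case using pCons by (simp add: map_poly_pCons frob_add frob_mult)
qed simp

lemma poly_funpow_frob_to_ac:
  "poly (map_poly to_ac p) x = 0 \<Longrightarrow> poly (map_poly to_ac p) ((frob ^^ k) x) = 0"
  by (induction k) (auto simp: poly_frob_to_ac)

section \<open>The Frobenius period of an element\<close>

lemma ex_funpow_frob_fixed:
  obtains k where "k > 0" "(frob ^^ k) x = x"
proof -
  obtain p where p: "p \<noteq> 0" "poly (map_poly to_ac p) x = 0"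
    using alg_closure_algebraic by blast
  \<comment> \<open>The orbit stays among the finitely many roots of \<open>p\<close>, so two
    iterates coincide, and injectivity cancels the smaller exponent.\<close>
  have "range (\<lambda>k. (frob ^^ k) x) \<subseteq> {y. poly (map_poly to_ac p) y = 0}"
    using poly_funpow_frob_to_ac[OF p(2)] by auto
  moreover have "finite {y. poly (map_poly to_ac p) y = 0}"
    using p by (intro poly_roots_finite) simp
  ultimately have "finite (range (\<lambda>k. (frob ^^ k) x))" by (rule finite_subset)
  hence "\<not> inj (\<lambda>k. (frob ^^ k) x)" by (meson finite_imageD infinite_UNIV_nat)
  then obtain i j where "i < j" "(frob ^^ i) x = (frob ^^ j) x"
    unfolding inj_def by (metis linorder_neqE_nat)
  thus ?thesis using that[of "j - i"] funpow_frob_fixed_diff[of i x j] by simp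
qed

text \<open>This is the size of the Frobenius orbit of \<open>x\<close>, equivalently the degree of
  \<open>x\<close> over the base field.\<close>

definition frob_period :: "'k::finite_field alg_closure \<Rightarrow> nat" where
  "frob_period x = (LEAST k. k > 0 \<and> (frob ^^ k) x = x)"

lemma
  shows frob_period_pos: "frob_period x > 0"
    and funpow_frob_period: "(frob ^^ frob_period x) x = x"
proof -
  have "frob_period x > 0 \<and> (frob ^^ frob_period x) x = x"
    unfolding frob_period_def by (rule LeastI_ex) (meson ex_funpow_frob_fixed)
  thus "frob_period x > 0" "(frob ^^ frob_period x) x = x" by auto
qed

lemma funpow_frob_fixed_iff: "(frob ^^ k) x = x \<longleftrightarrow> frob_period x dvd k"
proof
  assume k: "(frob ^^ k) x = x"
  \<comment> \<open>The gcd is itself a positive fixing exponent, so minimality makes it equal to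
    the period.\<close>
  have "gcd k (frob_period x) > 0" using frob_period_pos[of x] by simp
  moreover have "(frob ^^ gcd k (frob_period x)) x = x"
    using k funpow_frob_period by (rule funpow_frob_fixed_gcd)
  ultimately have "frob_period x \<le> gcd k (frob_period x)"
    unfolding frob_period_def by (intro Least_le) simp
  thus "frob_period x dvd k"
    by (metis frob_period_pos gcd_dvd1 gcd_le2_nat le_antisym less_numeral_extra(3))
qed (rule funpow_frob_fixed_dvd[OF funpow_frob_period])

lemma inj_on_frob_orbit: "inj_on (\<lambda>i. (frob ^^ i) x) {..<frob_period x}"
proof (rule linorder_inj_onI)
  fix i j assume ij: "i < j" "i \<in> {..<frob_period x}" "j \<in> {..<frob_period x}"
  show "(frob ^^ i) x \<noteq> (frob ^^ j) x"
  proof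
    assume "(frob ^^ i) x = (frob ^^ j) x"
    hence "frob_period x dvd j - i"
      using funpow_frob_fixed_diff[of i x j] ij by (simp add: funpow_frob_fixed_iff)
    thus False using ij by (auto dest: dvd_imp_le)
  qed
qed auto

section \<open>Periods as degrees of irreducible polynomials\<close>

lemma frob_period_le_degree:
  assumes "p \<noteq> 0" "poly (map_poly to_ac p) x = 0"
  shows "frob_period x \<le> Polynomial.degree p"
proof -
  have "frob_period x = card ((\<lambda>i. (frob ^^ i) x) ` {..<frob_period x})"
    by (simp add: card_image inj_on_frob_orbit)
  also have "\<dots> \<le> card {y. poly (map_poly to_ac p) y = 0}"
    using assms by (intro card_mono poly_roots_finite) (auto intro: poly_funpow_frob_to_ac)
  also have "\<dots> \<le> Polynomial.degree (map_poly to_ac p)"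
    using assms by (intro card_poly_roots_bound) auto
  finally show ?thesis by simp
qed

text \<open>In a factorization, the factor that vanishes at \<open>x\<close> already has the full
  degree by \<open>frob_period_le_degree\<close>, which leaves a constant for the other one.\<close>

lemma irreducible_if_degree_eq_frob_period:
  fixes p :: "'k::finite_field poly"
  assumes "poly (map_poly to_ac p) x = 0" "Polynomial.degree p = frob_period x"
  shows "Factorial_Ring.irreducible p"
proof (rule Factorial_Ring.irreducibleI)
  show p0: "p \<noteq> 0" using assms(2) frob_period_pos[of x] by auto
  show "\<not> p dvd 1"
    using assms(2) frob_period_pos[of x] by (auto simp: is_unit_iff_degree p0)
  fix a b assume ab: "p = a * b"
  hence ab0: "a \<noteq> 0" "b \<noteq> 0" using p0 by auto
  have "poly (map_poly to_ac a) x = 0 \<or> poly (map_poly to_ac b) x = 0"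
    using assms(1) by (simp add: ab map_poly_to_ac_mult)
  hence "frob_period x \<le> Polynomial.degree a \<or> frob_period x \<le> Polynomial.degree b"
    using ab0 frob_period_le_degree by blast
  moreover have "Polynomial.degree a + Polynomial.degree b = frob_period x"
    using ab0 assms(2) by (simp add: ab degree_mult_eq)
  ultimately show "a dvd 1 \<or> b dvd 1"
    using ab0 by (auto simp: is_unit_iff_degree)
qed

text \<open>The product of linear factors over the Frobenius orbit of \<open>x\<close> is unchanged
  when the Frobenius map is applied to its coefficients, so these lie in the base field.\<close>

lemma ex_min_poly:
  fixes x :: "'k::finite_field alg_closure"
  obtains p :: "'k poly" where "Polynomial.lead_coeff p = 1"
    "Polynomial.degree p = frob_period x"
    "set_mset (zeros p) = (\<lambda>i. (frob ^^ i) x) ` {..<frob_period x}"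
    "poly (map_poly to_ac p) x = 0"
proof -
  define M where "M = image_mset (\<lambda>i. (frob ^^ i) x) (mset_set {..<frob_period x})"
  define P where "P = (\<Prod>y\<in>#M. [:-y, 1:])"
  have "image_mset frob M = image_mset (\<lambda>i. (frob ^^ i) x) (image_mset Suc (mset_set {..<frob_period x}))"
    by (simp add: M_def multiset.map_comp comp_def)
  also have "image_mset Suc (mset_set {..<frob_period x}) = mset_set {1..frob_period x}"
    by (simp add: image_mset_mset_set lessThan_atLeast0 image_Suc_atLeastLessThan atLeastLessThanSuc_atLeastAtMost)
  also have "{1..frob_period x} = insert (frob_period x) {1..<frob_period x}"
    using frob_period_pos[of x] by auto
  \<comment> \<open>Index \<open>frob_period x\<close> gives the same element as index
    \<open>0\<close>, so the shifted orbit wraps around to \<open>M\<close>.\<close>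
  also have "image_mset (\<lambda>i. (frob ^^ i) x) (mset_set \<dots>) =
             image_mset (\<lambda>i. (frob ^^ i) x) (mset_set (insert 0 {1..<frob_period x}))"
    by (simp add: funpow_frob_period)
  also have "insert 0 {1..<frob_period x} = {..<frob_period x}"
    using frob_period_pos[of x] by auto
  finally have M: "image_mset frob M = M" by (simp only: M_def)
  have "map_poly frob P = (\<Prod>y\<in>#image_mset frob M. [:-y, 1:])"
    by (simp add: P_def map_poly_frob_prod_mset map_poly_pCons frob_uminus multiset.map_comp comp_def)
  hence "map_poly frob P = P" by (simp only: M P_def)
  hence "Polynomial.coeff (map_poly frob P) i = Polynomial.coeff P i" for i
    by (rule arg_cong)
  hence "frob (Polynomial.coeff P i) = Polynomial.coeff P i" for i
    by (simp only: coeff_map_poly[of frob, OF frob_0])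
  hence "Polynomial.coeff P i \<in> range to_ac" for i
    unfolding range_to_ac by simp
  hence P: "map_poly to_ac (map_poly of_ac P) = P"
    by (intro poly_eqI) (simp add: coeff_map_poly to_ac_of_ac)
  have P': "P = (\<Prod>i<frob_period x. [:- (frob ^^ i) x, 1:])"
    by (simp add: P_def M_def multiset.map_comp comp_def prod_unfold_prod_mset)
  have lc: "Polynomial.lead_coeff P = 1" unfolding P' lead_coeff_prod by simp
  have deg: "Polynomial.degree P = frob_period x"
    unfolding P' by (subst degree_prod_sum_eq) auto
  have "Polynomial.degree (map_poly of_ac P) = frob_period x"
    using degree_map_poly_to_ac[of "map_poly of_ac P"] by (simp only: P deg)
  moreover have "of_ac (1 :: 'k alg_closure) = 1" by (rule of_ac_eqI) simp
  hence "Polynomial.lead_coeff (map_poly of_ac P) = 1"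
    using calculation lc by (simp add: coeff_map_poly deg)
  moreover have "zeros (map_poly of_ac P) = M"
    unfolding zeros_def P by (simp only: P_def proots_prod_linear)
  hence "set_mset (zeros (map_poly of_ac P)) = (\<lambda>i. (frob ^^ i) x) ` {..<frob_period x}"
    by (simp add: M_def)
  moreover have "poly (map_poly to_ac (map_poly of_ac P)) x = 0"
    unfolding P using frob_period_pos[of x] by (auto simp: P' poly_prod intro!: bexI[of _ 0])
  ultimately show ?thesis using that by blast
qed

lemma root_iff_mem_zeros: "p \<noteq> 0 \<Longrightarrow> x \<in># zeros p \<longleftrightarrow> poly (map_poly to_ac p) x = 0"
  by (simp add: zeros_def)

lemma degree_eq_frob_period_if_irreducible:
  fixes p :: "'k::finite_field poly"
  assumes "Factorial_Ring.irreducible p" "poly (map_poly to_ac p) x = 0"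
  shows "Polynomial.degree p = frob_period x"
proof -
  obtain h :: "'k poly" where h: "Polynomial.degree h = frob_period x"
    and h_root: "poly (map_poly to_ac h) x = 0"
    by (rule ex_min_poly)
  have h0: "h \<noteq> 0" using h frob_period_pos[of x] by auto
  have "map_poly to_ac p = map_poly to_ac (p div h) * map_poly to_ac h + map_poly to_ac (p mod h)"
    by (simp flip: map_poly_to_ac_mult map_poly_to_ac_add)
  hence "poly (map_poly to_ac (p mod h)) x = 0"
    using assms(2) h_root by simp
  \<comment> \<open>A nonzero remainder would vanish at \<open>x\<close> with degree below the
    period.\<close>
  hence "p mod h = 0"
    using frob_period_le_degree[of "p mod h" x] degree_mod_less[OF h0, of p] h by linarith
  hence "h dvd p" by (simp add: mod_eq_0_iff_dvd)
  moreover have "\<not> h dvd 1"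
    using h0 h frob_period_pos[of x] by (simp add: is_unit_iff_degree)
  ultimately have "p dvd h"
    using assms(1) by (meson Factorial_Ring.irreducibleD')
  moreover have "p \<noteq> 0" using assms(1) by auto
  ultimately show ?thesis
    using \<open>h dvd p\<close> h0 h dvd_imp_degree_le by (metis le_antisym)
qed

section \<open>Field generators characterized by their period\<close>

lemma poly_mem_adjoin: "poly (map_poly to_ac p) x \<in> adjoin x"
proof -
  let ?R = "ring_of_type_algebra :: 'a alg_closure ring"
  interpret R: field ?R by (rule field_from_type_algebra)
  have R: "carrier ?R = UNIV" "add ?R = (+)" "zero ?R = 0" "monoid.mult ?R = (*)"
    by (auto simp: ring_of_type_algebra_def)
  have zero: "0 \<in> adjoin x"
    using R.zero_in_generate[of "insert x (range to_ac)"] by (simp add: adjoin_def R)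
  have add: "a + b \<in> adjoin x" if "a \<in> adjoin x" "b \<in> adjoin x" for a b
    using generate_field.eng_add[of a ?R _ b] that by (simp add: adjoin_def R)
  have mult: "a * b \<in> adjoin x" if "a \<in> adjoin x" "b \<in> adjoin x" for a b
    using generate_field.eng_mult[of a ?R _ b] that by (simp add: adjoin_def R)
  have gen: "a \<in> adjoin x" if "a \<in> insert x (range to_ac)" for a
    using that unfolding adjoin_def by (rule generate_field.incl)
  show ?thesis
    by (induction p) (auto simp: map_poly_pCons intro: zero add mult gen)
qed

lemma adjoin_subset_Fqn:
  assumes "(frob ^^ n) x = x" "n > 0"
  shows "adjoin x \<subseteq> Fqn n"
proof -
  let ?R = "ring_of_type_algebra :: 'a alg_closure ring"
  interpret R: field ?R by (rule field_from_type_algebra)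
  have "(frob ^^ n) (to_ac a) = to_ac a" for a :: 'a
    using range_to_ac[where 'k='a] by (induction n) auto
  hence "insert x (range to_ac) \<subseteq> {x. x ^ (CARD('a) ^ n) = x}"
    using assms by (auto simp: funpow_frob)
  thus ?thesis
    unfolding adjoin_def Fqn_eq[OF assms(2)]
    by (intro R.generate_field_min_subfield1 subfield_roots) (auto simp: ring_of_type_algebra_def)
qed

lemma
  assumes "n > 0"
  shows finite_Fqn: "finite (Fqn n :: 'k::finite_field alg_closure set)"
    and card_Fqn: "card (Fqn n :: 'k alg_closure set) = CARD('k) ^ n"
proof -
  show *: "card (Fqn n :: 'k alg_closure set) = CARD('k) ^ n"
    unfolding Fqn_eq[OF assms] by (rule card_roots[OF assms])
  show "finite (Fqn n :: 'k alg_closure set)"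
    by (rule card_ge_0_finite) (simp add: *)
qed

text \<open>Polynomials of degree below the period take distinct values at \<open>x\<close>, since a
  difference of two of them is too small in degree to vanish there unless it is zero.\<close>

lemma card_adjoin_ge:
  fixes x :: "'k::finite_field alg_closure"
  shows "CARD('k) ^ frob_period x \<le> card (adjoin x)"
proof -
  \<comment> \<open>Coefficient lists of fixed length, possibly with trailing zeros, encode these
    polynomials; the form matches \<open>card_lists_length_eq\<close>.\<close>
  define L where "L = {cs :: 'k list. set cs \<subseteq> UNIV \<and> length cs = frob_period x}"
  define ev where "ev cs = poly (map_poly to_ac (Poly cs)) x" for cs :: "'k list"
  have "inj_on ev L"
  proof (rule inj_onI)
    fix as bs assume L: "as \<in> L" "bs \<in> L" and eq: "ev as = ev bs"
    have coeff: "Polynomial.coeff (Poly cs) i = (if i < frob_period x then cs ! i else 0)"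
      if "cs \<in> L" for cs i
      using that by (simp add: L_def nth_default_def)
    let ?p = "Poly as - Poly bs"
    have "poly (map_poly to_ac ?p) x = 0"
      using eq by (simp add: ev_def map_poly_to_ac_diff)
    moreover have "Polynomial.degree ?p < frob_period x"
      using frob_period_pos[of x] by (intro degree_lessI) (auto simp: coeff L simp del: coeff_Poly_eq)
    ultimately have "?p = 0"
      using frob_period_le_degree[of ?p x] by linarith
    hence "Polynomial.coeff (Poly as) i = Polynomial.coeff (Poly bs) i" for i
      by (simp del: coeff_Poly_eq)
    hence "as ! i = bs ! i" if "i < frob_period x" for i
      using that coeff[OF L(1), of i] coeff[OF L(2), of i] by metis
    thus "as = bs"
      using L by (intro nth_equalityI) (auto simp: L_def)
  qed
  hence "CARD('k) ^ frob_period x = card (ev ` L)"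
    using card_lists_length_eq[of "UNIV :: 'k set" "frob_period x"] unfolding L_def
    by (subst card_image) simp_all
  also have "\<dots> \<le> card (adjoin x)"
  proof (rule card_mono)
    show "finite (adjoin x)"
      using finite_subset[OF adjoin_subset_Fqn finite_Fqn] funpow_frob_period frob_period_pos by blast
  qed (auto simp: ev_def poly_mem_adjoin)
  finally show ?thesis .
qed

text \<open>Cardinalities decide: \<open>adjoin x\<close> lies in
  \<open>Fqn (frob_period x)\<close>, and \<open>card_adjoin_ge\<close> bounds its size from below
  by the size of that field.\<close>

lemma gens_eq:
  assumes "n > 0"
  shows "gens n = {x :: 'k::finite_field alg_closure. frob_period x = n}"
proof (rule Set.set_eqI, unfold mem_Collect_eq, rule iffI)
  fix x :: "'k alg_closure"
  have q: "CARD('k) > 1" using card_mono[of UNIV "{0, 1 :: 'k}"] by simp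
  have sub: "adjoin x \<subseteq> Fqn (frob_period x)"
    using funpow_frob_period frob_period_pos by (rule adjoin_subset_Fqn)
  {
    assume "x \<in> gens n"
    hence x: "x \<in> Fqn n" "adjoin x = Fqn n" by (auto simp: gens_def)
    have "frob_period x dvd n"
      using x(1) by (simp add: Fqn_eq[OF assms] flip: funpow_frob funpow_frob_fixed_iff)
    \<comment> \<open>Both sizes are powers of \<open>CARD('k) > 1\<close>, so the exponents compare
      in the same way.\<close>
    moreover have "card (Fqn n :: 'k alg_closure set) \<le> card (Fqn (frob_period x) :: 'k alg_closure set)"
      using sub x(2) frob_period_pos by (metis card_mono finite_Fqn)
    hence "n \<le> frob_period x"
      using q by (simp add: card_Fqn assms frob_period_pos)
    ultimately show "frob_period x = n"
      using assms by (meson dvd_imp_le le_antisym)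
  }
  {
    assume n: "frob_period x = n"
    have "x \<in> Fqn n"
      using funpow_frob_period[of x] by (simp add: Fqn_eq[OF assms] n funpow_frob)
    moreover have "adjoin x = Fqn n"
      using sub card_adjoin_ge[of x] by (intro card_seteq finite_Fqn assms) (simp_all add: n card_Fqn assms)
    ultimately show "x \<in> gens n" by (simp add: gens_def)
  }
qed

section \<open>Periods along orbits and of diamond products\<close>

lemma frob_period_frob [simp]: "frob_period (frob x) = frob_period x"
proof -
  have "(frob ^^ k) (frob x) = frob x \<longleftrightarrow> (frob ^^ k) x = x" for k
    unfolding funpow_swap1[symmetric] using bij_is_inj[OF bij_frob] by (rule inj_eq)
  \<comment> \<open>A period is determined by its set of multiples.\<close>
  thus ?thesis by (simp add: funpow_frob_fixed_iff) (metis dvd_antisym dvd_refl)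
qed

lemma frob_period_funpow_frob [simp]: "frob_period ((frob ^^ k) x) = frob_period x"
  by (induction k) auto

lemma funpow_frob_mem:
  "frobenius_invariant A \<Longrightarrow> x \<in> A \<Longrightarrow> (frob ^^ k) x \<in> A"
  by (induction k) (auto simp: frobenius_invariant_def)

lemma funpow_frob_diamond:
  assumes "frobenius_invariant A" "frobenius_invariant B" "diamond_product A B d"
    and "a \<in> A" "b \<in> B"
  shows "(frob ^^ k) (d a b) = d ((frob ^^ k) a) ((frob ^^ k) b)"
  using assms by (induction k) (auto simp: diamond_product_def funpow_frob_mem)

text \<open>Transfers the results below on the first argument to the second.\<close>

lemma diamond_product_swap:
  "diamond_product A B d \<Longrightarrow> diamond_product B A (\<lambda>b a. d a b)"
  by (auto simp: diamond_product_def)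

lemma coprime_if_frob_period_diamond:
  assumes "frobenius_invariant A" "frobenius_invariant B" "diamond_product A B d"
    and "a \<in> A" "b \<in> B"
    and "frob_period (d a b) = frob_period a * frob_period b"
  shows "coprime (frob_period a) (frob_period b)"
proof -
  let ?l = "lcm (frob_period a) (frob_period b)"
  have "(frob ^^ ?l) a = a" "(frob ^^ ?l) b = b"
    by (simp_all add: funpow_frob_fixed_iff)
  hence "(frob ^^ ?l) (d a b) = d a b"
    by (simp add: funpow_frob_diamond[OF assms(1-5)])
  \<comment> \<open>The left side is the product of the two periods, which is the period of
    \<open>d a b\<close> by assumption; cancelling the lcm leaves a gcd dividing
    \<open>1\<close>.\<close>
  hence "?l * gcd (frob_period a) (frob_period b) dvd ?l * 1"
    using assms(6) by (simp add: funpow_frob_fixed_iff lcm_gcd_prod)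
  moreover have "?l \<noteq> 0" using frob_period_pos[of a] frob_period_pos[of b] by simp
  ultimately have "gcd (frob_period a) (frob_period b) dvd 1"
    by (metis dvd_times_left_cancel_iff)
  thus ?thesis by (simp add: coprime_iff_gcd_eq_1)
qed

lemma diamond_cancel_left:
  assumes "frobenius_invariant A" "frobenius_invariant B" "diamond_product A B d"
    and "a \<in> A" "b \<in> B"
    and period: "frob_period (d a b) = frob_period a * frob_period b"
    and eq: "d a b = d (frob_pow k a) b"
  shows "a = frob_pow k a"
proof -
  define m n where "m = frob_period a" and "n = frob_period b"
  define r where "r = nat (k mod int m)"
  have k: "frob_pow k a = (frob ^^ r) a"
    unfolding r_def m_def by (rule frob_pow_fixed_conv[OF funpow_frob_period frob_period_pos])
  have "coprime n m"
    using coprime_if_frob_period_diamond[OF assms(1-6)] by (simp add: m_def n_def coprime_commute)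
  \<comment> \<open>The number \<open>n * j\<close> is \<open>0\<close> modulo the period of
    \<open>b\<close> and \<open>1\<close> modulo that of \<open>a\<close>, so
    \<open>n * j * r\<close> iterations fix \<open>b\<close> and act on \<open>a\<close> like
    \<open>frob_pow k\<close>.\<close>
  then obtain j where "[n * j = 1] (mod m)"
    using cong_solve_coprime_nat[of n m] by auto
  hence "[n * j * r = 1 * r] (mod m)" by (rule cong_mult) simp
  hence "(n * j * r) mod m = r mod m" by (simp add: cong_def)
  hence a: "(frob ^^ (n * j * r)) a = (frob ^^ r) a"
    by (metis m_def funpow_frob_period funpow_mod_eq)
  have b: "(frob ^^ (n * j * r)) b = b"
    by (simp add: funpow_frob_fixed_iff n_def)
  \<comment> \<open>The assumed equality now says that these iterations fix \<open>d a b\<close>, so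
    their number is a multiple of its period and hence of \<open>m\<close>.\<close>
  have "(frob ^^ (n * j * r)) (d a b) = d a b"
    unfolding funpow_frob_diamond[OF assms(1-5)] a b using eq k by simp
  hence "m dvd n * j * r"
    using period by (auto simp: funpow_frob_fixed_iff m_def dest: dvd_mult_left)
  hence "(frob ^^ (n * j * r)) a = a" by (simp add: funpow_frob_fixed_iff m_def)
  thus ?thesis using a k by simp
qed

lemma frob_period_dvd_if_diamond_cancel_left:
  assumes "frobenius_invariant A" "frobenius_invariant B" "diamond_product A B d"
    and "a \<in> A" "b \<in> B"
    and "coprime (frob_period a) (frob_period b)"
    and cancel: "\<And>k::nat. d a b = d (frob_pow (int k) a) b \<Longrightarrow> a = frob_pow (int k) a"
  shows "frob_period a dvd frob_period (d a b)"
proof -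
  \<comment> \<open>Chosen to fix both \<open>d a b\<close> and \<open>b\<close>, so that only
    \<open>a\<close> moves and cancellation applies; coprimality then removes the factor
    \<open>frob_period b\<close>.\<close>
  define k where "k = frob_period (d a b) * frob_period b"
  have "d a b = (frob ^^ k) (d a b)"
    by (simp add: eq_commute[of "d a b"] funpow_frob_fixed_iff k_def)
  also have "\<dots> = d ((frob ^^ k) a) ((frob ^^ k) b)"
    by (rule funpow_frob_diamond[OF assms(1-5)])
  also have "(frob ^^ k) b = b"
    by (simp add: funpow_frob_fixed_iff k_def)
  finally have "(frob ^^ k) a = a"
    using cancel[of k] by (simp add: frob_pow_def)
  hence "frob_period a dvd frob_period (d a b) * frob_period b"
    by (simp add: funpow_frob_fixed_iff k_def)
  thus ?thesis
    using assms(6) by (simp add: coprime_dvd_mult_left_iff)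
qed

section \<open>Degree and irreducibility of composed products\<close>

lemma degree_prod_mset:
  fixes p :: "'a \<Rightarrow> 'b::idom poly"
  assumes "\<And>x. x \<in># M \<Longrightarrow> p x \<noteq> 0"
  shows "Polynomial.degree (\<Prod>x\<in>#M. p x) = (\<Sum>x\<in>#M. Polynomial.degree (p x))"
  using assms
proof (induction M)
  case (add x M)
  have "(\<Prod>x\<in>#M. p x) \<noteq> 0" using add.prems by (auto simp: prod_mset_zero_iff)
  thus ?case using add by (simp add: degree_mult_eq)
qed simp

lemma size_zeros:
  assumes "Polynomial.lead_coeff f = 1"
  shows "size (zeros f) = Polynomial.degree f"
  using prod_zeros[OF assms] degree_map_poly_to_ac[of f]
  by (simp add: degree_prod_mset del: degree_map_poly_to_ac)

text \<open>A single pair of zeros decides irreducibility, because both degree criteria apply to the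
  one root \<open>d a b\<close>.\<close>

lemma irreducible_composed_product_iff:
  fixes f g :: "'k::finite_field poly"
  assumes d: "diamond_product A B d"
    and f: "Polynomial.lead_coeff f = 1" "Factorial_Ring.irreducible f" "set_mset (zeros f) \<subseteq> A"
    and g: "Polynomial.lead_coeff g = 1" "Factorial_Ring.irreducible g" "set_mset (zeros g) \<subseteq> B"
    and a: "a \<in># zeros f" and b: "b \<in># zeros g"
  shows "Factorial_Ring.irreducible (composed_product d f g) \<longleftrightarrow>
           frob_period (d a b) = frob_period a * frob_period b"
proof -
  let ?h = "composed_product d f g"
  have h: "map_poly to_ac ?h = (\<Prod>\<alpha>\<in>#zeros f. \<Prod>\<beta>\<in>#zeros g. [:- d \<alpha> \<beta>, 1:])"
    using d f(1,3) g(1,3) by (rule map_poly_composed_product)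
  have "f \<noteq> 0" "g \<noteq> 0" using f g by auto
  hence "Polynomial.degree f = frob_period a" "Polynomial.degree g = frob_period b"
    using a b f g by (simp_all add: degree_eq_frob_period_if_irreducible root_iff_mem_zeros)
  moreover have "Polynomial.degree (map_poly to_ac ?h) = size (zeros f) * size (zeros g)"
    unfolding h by (subst degree_prod_mset) (auto simp: degree_prod_mset prod_mset_zero_iff)
  ultimately have deg: "Polynomial.degree ?h = frob_period a * frob_period b"
    using f g by (simp add: size_zeros)
  have root: "poly (map_poly to_ac ?h) (d a b) = 0"
    unfolding h poly_prod_mset prod_mset_zero_iff using a b
    by (force simp: poly_prod_mset prod_mset_zero_iff)
  show ?thesis
    using deg degree_eq_frob_period_if_irreducible[OF _ root] irreducible_if_degree_eq_frob_period[OF root]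
    by metis
qed

text \<open>If \<open>A \<inter> gens m\<close> or \<open>B \<inter> gens n\<close> is empty, the
  first two statements and conjugate cancellation hold vacuously, so the third reduces to
  \<open>gcd m n = 1\<close>. The assumption \<open>nondegenerate\<close> excludes exactly the case
  where this fails.\<close>

theorem theorem2p7:
  fixes A B :: "'k::finite_field alg_closure set"
    and d :: "'k alg_closure \<Rightarrow> 'k alg_closure \<Rightarrow> 'k alg_closure"
    and m n :: nat
  assumes "m > 0" and "n > 0"
    and "frobenius_invariant A" and "frobenius_invariant B"
    and "diamond_product A B d"
    and nondegenerate: "A \<inter> gens m \<noteq> {} \<and> B \<inter> gens n \<noteq> {} \<or> gcd m n = 1"
  shows "((\<forall>\<alpha>\<in>A \<inter> gens m. \<forall>\<beta>\<in>B \<inter> gens n. d \<alpha> \<beta> \<in> gens (m * n)) \<longleftrightarrow>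
          (\<forall>f g :: 'k poly.
             Polynomial.lead_coeff f = 1 \<and> Factorial_Ring.irreducible f \<and>
             Polynomial.lead_coeff g = 1 \<and> Factorial_Ring.irreducible g \<and>
             set_mset (zeros f) \<subseteq> A \<inter> gens m \<and> set_mset (zeros g) \<subseteq> B \<inter> gens n \<longrightarrow>
             Factorial_Ring.irreducible (composed_product d f g)))
       \<and> ((\<forall>\<alpha>\<in>A \<inter> gens m. \<forall>\<beta>\<in>B \<inter> gens n. d \<alpha> \<beta> \<in> gens (m * n)) \<longleftrightarrow>
          gcd m n = 1 \<and> conjugate_cancellation A B m n d)"
  (is "(?P \<longleftrightarrow> ?Irr) \<and> (?P \<longleftrightarrow> ?Canc)")
proof (intro conjI iffI)
  note inv = assms(3-5) and inv' = assms(4,3) diamond_product_swap[OF assms(5)]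
  have gens: "gens m = {x :: 'k alg_closure. frob_period x = m}"
    "gens n = {x :: 'k alg_closure. frob_period x = n}"
    "gens (m * n) = {x :: 'k alg_closure. frob_period x = m * n}"
    using assms(1,2) by (simp_all add: gens_eq)
  {
    assume P: ?P
    show ?Irr
    proof (intro allI impI, elim conjE)
      fix f g :: "'k poly"
      assume f: "Polynomial.lead_coeff f = 1" "Factorial_Ring.irreducible f" "set_mset (zeros f) \<subseteq> A \<inter> gens m"
        and g: "Polynomial.lead_coeff g = 1" "Factorial_Ring.irreducible g" "set_mset (zeros g) \<subseteq> B \<inter> gens n"
      have ne: "zeros h \<noteq> {#}"
        if "Polynomial.lead_coeff h = 1" "Factorial_Ring.irreducible h" for h :: "'k poly"
      proof
        assume "zeros h = {#}"
        hence "Polynomial.degree h = 0" using size_zeros[OF that(1)] by simp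
        thus False using that(2) by (auto simp: Factorial_Ring.irreducible_def is_unit_iff_degree)
      qed
      obtain a b where ab: "a \<in># zeros f" "b \<in># zeros g"
        using ne f g by (meson multiset_nonemptyE)
      hence "frob_period (d a b) = frob_period a * frob_period b"
        using P f g by (auto simp: gens subset_iff)
      thus "Factorial_Ring.irreducible (composed_product d f g)"
        using irreducible_composed_product_iff[OF assms(5) f(1,2) _ g(1,2) _ ab] f(3) g(3) by blast
    qed
  }
  {
    assume Irr: ?Irr
    show ?P
    proof (intro ballI)
      fix a b assume ab: "a \<in> A \<inter> gens m" "b \<in> B \<inter> gens n"
      \<comment> \<open>The zeros of the minimal polynomials are the orbits of \<open>a\<close> and
        \<open>b\<close>, which stay in \<open>A \<inter> gens m\<close> and
        \<open>B \<inter> gens n\<close> by Frobenius invariance and constancy of the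
        period.\<close>
      obtain f :: "'k poly" where f: "Polynomial.lead_coeff f = 1" "Polynomial.degree f = frob_period a"
        "set_mset (zeros f) = (\<lambda>i. (frob ^^ i) a) ` {..<frob_period a}" "poly (map_poly to_ac f) a = 0"
        by (rule ex_min_poly)
      obtain g :: "'k poly" where g: "Polynomial.lead_coeff g = 1" "Polynomial.degree g = frob_period b"
        "set_mset (zeros g) = (\<lambda>i. (frob ^^ i) b) ` {..<frob_period b}" "poly (map_poly to_ac g) b = 0"
        by (rule ex_min_poly)
      have irr: "Factorial_Ring.irreducible f" "Factorial_Ring.irreducible g"
        using f g irreducible_if_degree_eq_frob_period by blast+
      have sub: "set_mset (zeros f) \<subseteq> A \<inter> gens m" "set_mset (zeros g) \<subseteq> B \<inter> gens n"
        using ab assms(3,4) by (auto simp: f g gens funpow_frob_mem)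
      have "f \<noteq> 0" "g \<noteq> 0" using f g by auto
      hence zeros: "a \<in># zeros f" "b \<in># zeros g" using f(4) g(4) by (simp_all add: root_iff_mem_zeros)
      have "Factorial_Ring.irreducible (composed_product d f g)"
        using Irr f(1) g(1) irr sub by blast
      hence "frob_period (d a b) = frob_period a * frob_period b"
        using irreducible_composed_product_iff[OF assms(5) f(1) irr(1) _ g(1) irr(2) _ zeros] sub by blast
      thus "d a b \<in> gens (m * n)" using ab by (simp add: gens)
    qed
  }
  {
    assume P: ?P
    show "gcd m n = 1"
      using nondegenerate
    proof
      assume "A \<inter> gens m \<noteq> {} \<and> B \<inter> gens n \<noteq> {}"
      then obtain a b where ab: "a \<in> A \<inter> gens m" "b \<in> B \<inter> gens n" by blast
      hence "coprime (frob_period a) (frob_period b)"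
        using P by (intro coprime_if_frob_period_diamond[OF inv]) (auto simp: gens)
      thus "gcd m n = 1" using ab by (simp add: gens coprime_iff_gcd_eq_1)
    qed
    show "conjugate_cancellation A B m n d"
      unfolding conjugate_cancellation_def
    proof (intro allI impI ballI conjI)
      fix k a b assume ab: "a \<in> A \<inter> gens m" "b \<in> B \<inter> gens n"
      hence period: "frob_period (d a b) = frob_period a * frob_period b"
        using P by (auto simp: gens)
      show "a = frob_pow k a" if "d a b = d (frob_pow k a) b"
        using ab period that by (intro diamond_cancel_left[OF inv]) auto
      show "b = frob_pow k b" if "d a b = d a (frob_pow k b)"
        using ab period that by (intro diamond_cancel_left[OF inv', of b a k]) (auto simp: mult.commute)
    qed
  }
  {
    assume Canc: ?Canc
    hence cop: "coprime m n" by (simp add: coprime_iff_gcd_eq_1)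
    show ?P
    proof (intro ballI)
      fix a b assume ab: "a \<in> A \<inter> gens m" "b \<in> B \<inter> gens n"
      hence mem: "a \<in> A" "b \<in> B" and period: "frob_period a = m" "frob_period b = n"
        by (auto simp: gens)
      have canc: "d a b = d (frob_pow k a) b \<Longrightarrow> a = frob_pow k a"
        "d a b = d a (frob_pow k b) \<Longrightarrow> b = frob_pow k b" for k
        using Canc ab unfolding conjugate_cancellation_def by auto
      have "m dvd frob_period (d a b)"
        using frob_period_dvd_if_diamond_cancel_left[OF inv mem] canc(1) cop period by blast
      moreover have "n dvd frob_period (d a b)"
        using frob_period_dvd_if_diamond_cancel_left[OF inv' mem(2,1)] canc(2) cop period
        by (metis coprime_commute)
      ultimately have "m * n dvd frob_period (d a b)"
        using cop by (rule divides_mult)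
      \<comment> \<open>This gives the reverse divisibility, since \<open>m * n\<close> iterations
        fix both arguments.\<close>
      moreover have "(frob ^^ (m * n)) (d a b) = d a b"
      proof -
        have "(frob ^^ (m * n)) a = a" "(frob ^^ (m * n)) b = b"
          by (simp_all add: funpow_frob_fixed_iff period)
        thus ?thesis by (simp add: funpow_frob_diamond[OF inv mem])
      qed
      hence "frob_period (d a b) dvd m * n" by (simp add: funpow_frob_fixed_iff)
      ultimately show "d a b \<in> gens (m * n)" by (simp add: gens dvd_antisym)
    qed
  }
qed

end
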